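(* Let $n \geq 3$ be an integer, put $N := \binom{n}{\lfloor n/2 \rfloor}$, and let $R$ be a nonzero unital commutative ring that is $n$-Vandermonde full. Then there exist $N$ directions $\mathbf{v}_1, \dots, \mathbf{v}_N \in R^n$ such that, for every multi-affine map $f : R^n \to R$, if $f|_{R\mathbf{v}_i}$ is affine-linear for all $1 \leq i \leq N$, then $f$ is affine-linear on $R^n$. Moreover, the bound $N$ is sharp, i.e. fewer than $N$ directions do not suffice: for every $m < N$ and all $\mathbf{w}_1, \dots, \mathbf{w}_m \in R^n$, there exists a multi-affine map $f : R^n \to R$ such that $f|_{R\mathbf{w}_i}$ is affine-linear for all $1 \leq i \leq m$ but $f$ is not affine-linear on $R^n$.
   Context: For $n \geq 2$ and a unital commutative ring $R$, let $p_n(\mathbf{x}) := \prod_{j=1}^n x_j \cdot \prod_{1 \leq j < k \leq n} (x_j - x_k) \in R[x_1,\dots,x_n]$, and let $I_{p_n} = I_{p_n}(R)$ be the ideal of $R$ generated by $\{p_n(\mathbf{r}) : \mathbf{r} \in R^n\}$. The ring $R$ is called $n$-Vandermonde full if $\mathrm{Ann}_R(I_{p_n}) = 0$, i.e. the only $a \in R$ with $a \cdot p_n(\mathbf{r}) = 0$ for all $\mathbf{r} \in R^n$ is $a = 0$. A map $f : R^n \to R$ is multi-affine if there are scalars $a_J \in R$ ($J \subseteq [n] := \{1,\dots,n\}$) with $f(\mathbf{x}) = \sum_{J \subseteq [n]} a_J \prod_{j \in J} x_j$ for all $\mathbf{x} \in R^n$. For $\mathbf{v} \in R^n$, $f|_{R\mathbf{v}}$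 is affine-linear if there is $m_{\mathbf{v}} \in R$ with $f(r\mathbf{v}) = f(0) + r\, m_{\mathbf{v}}$ for all $r \in R$. The map $f$ is affine-linear on $R^n$ if there are $a_1,\dots,a_n \in R$ with $f(c_1,\dots,c_n) = f(0) + \sum_{i=1}^n a_i c_i$ for all $c_1,\dots,c_n \in R$. *)

theory Defs
  imports "Jordan_Normal_Form.Matrix"
begin

text \<open>
  The free module \<open>R\<^sup>n\<close> is \<open>carrier_vec n\<close>, so coordinates are indexed by \<open>{..<n}\<close>
  rather than by \<open>{1..n}\<close>. A map \<open>R\<^sup>n \<Rightarrow> R\<close> is a function on all vectors of which only
  the values on \<open>carrier_vec n\<close> matter.
\<close>

definition vandermonde_value :: "nat \<Rightarrow> 'a::comm_ring_1 vec \<Rightarrow> 'a" where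
  "vandermonde_value n x =
     (\<Prod>j<n. x $ j) * (\<Prod>(j, k)\<in>{(j, k). j < k \<and> k < n}. x $ j - x $ k)"

text \<open>The ideals of \<open>R\<close> are the submodules of \<open>R\<close> as a module over itself.\<close>

definition ideal_generated :: "'a::comm_ring_1 set \<Rightarrow> 'a set" where
  "ideal_generated S = Modules.module.span (*) S"

definition annihilator :: "'a::comm_ring_1 set \<Rightarrow> 'a set" where
  "annihilator I = {a. \<forall>x\<in>I. a * x = 0}"

definition vandermonde_ideal :: "nat \<Rightarrow> 'a::comm_ring_1 set" where
  "vandermonde_ideal n = ideal_generated (vandermonde_value n ` carrier_vec n)"

text \<open>The type argument fixes the ring \<open>R\<close>.\<close>

definition vandermonde_full :: "'a::comm_ring_1 itself \<Rightarrow> nat \<Rightarrow> bool" where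
  "vandermonde_full _ n \<longleftrightarrow> annihilator (vandermonde_ideal n :: 'a set) = {0}"

lemma module_times: "Modules.module ((*) :: 'a::comm_ring_1 \<Rightarrow> 'a \<Rightarrow> 'a)"
  by (rule Modules.module.intro) (simp_all only: distrib_left distrib_right mult.assoc mult_1_left)

lemma annihilator_ideal_generated:
  "annihilator (ideal_generated S) = annihilator (S :: 'a::comm_ring_1 set)"
proof -
  interpret M: Modules.module "(*) :: 'a \<Rightarrow> 'a \<Rightarrow> 'a" by (rule module_times)
  have "a * x = 0" if a: "\<forall>x\<in>S. a * x = 0" and x: "x \<in> M.span S" for a x
    using x
  proof (induction rule: M.span_induct_alt)
    case base
    show ?case by simp
  next
    case (step c x y)
    have "a * (c * x + y) = c * (a * x) + a * y"
      by (simp only: distrib_left mult.left_commute)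
    then show ?case using a step by simp
  qed
  then show ?thesis
    unfolding annihilator_def ideal_generated_def by (blast intro: M.span_base)
qed

lemma vandermonde_full_iff:
  "vandermonde_full TYPE('a::comm_ring_1) n \<longleftrightarrow>
     (\<forall>a::'a. (\<forall>r\<in>carrier_vec n. a * vandermonde_value n r = 0) \<longrightarrow> a = 0)"
proof -
  have "annihilator T = {0} \<longleftrightarrow> (\<forall>a. (\<forall>x\<in>T. a * x = 0) \<longrightarrow> a = 0)" for T :: "'a set"
  proof -
    have "0 \<in> annihilator T" by (simp add: annihilator_def)
    then show ?thesis unfolding annihilator_def by blast
  qed
  then show ?thesis
    unfolding vandermonde_full_def vandermonde_ideal_def annihilator_ideal_generated ball_simps
    by (simp only: ball_simps)
qed

definition multi_affine :: "nat \<Rightarrow> ('a::comm_ring_1 vec \<Rightarrow> 'a) \<Rightarrow> bool" where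
  "multi_affine n f \<longleftrightarrow>
     (\<exists>a :: nat set \<Rightarrow> 'a. \<forall>x\<in>carrier_vec n. f x = (\<Sum>J\<in>Pow {..<n}. a J * (\<Prod>j\<in>J. x $ j)))"

definition affine_linear_along :: "nat \<Rightarrow> ('a::comm_ring_1 vec \<Rightarrow> 'a) \<Rightarrow> 'a vec \<Rightarrow> bool" where
  "affine_linear_along n f v \<longleftrightarrow> (\<exists>m. \<forall>r. f (r \<cdot>\<^sub>v v) = f (0\<^sub>v n) + r * m)"

definition affine_linear :: "nat \<Rightarrow> ('a::comm_ring_1 vec \<Rightarrow> 'a) \<Rightarrow> bool" where
  "affine_linear n f \<longleftrightarrow>
     (\<exists>a :: nat \<Rightarrow> 'a. \<forall>c\<in>carrier_vec n. f c = f (0\<^sub>v n) + (\<Sum>i<n. a i * c $ i))"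

end

theory Submission
  imports Defs "HOL-Computational_Algebra.Polynomial"
begin

text \<open>
  Let \<open>f\<close> be the multi-affine map with coefficients \<open>a J\<close>, and let \<open>f\<^sub>k\<close> be its homogeneous part of degree
  \<open>k\<close>. On a line \<open>R v\<close> the map is the polynomial \<open>\<Sum>k\<le>n. f\<^sub>k v * r ^ k\<close> in \<open>r\<close>. Over a Vandermonde full
  ring a polynomial of degree at most \<open>n\<close> without constant term that vanishes at every \<open>r\<close> is the zero
  polynomial (\<open>vandermonde_full_poly_zero\<close>), so \<open>f\<close> is affine-linear along \<open>v\<close> if and only if \<open>f\<^sub>k v = 0\<close>
  for all \<open>k\<close> from 2 to \<open>n\<close> (\<open>affine_linear_along_iff_level_forms\<close>). This turns both halves of the
  theorem into linear algebra over \<open>R\<close>, separately in each degree.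

  For the upper bound, let \<open>N = n choose (n div 2)\<close>. One needs \<open>N\<close> vectors such that no nonzero
  squarefree form, of whatever degree, vanishes on all of them. The indicator vectors of the ballot
  sets have this property over every commutative ring; these are the subsets \<open>S\<close> of \<open>{..<n}\<close> such that
  every initial segment \<open>{..<m}\<close> contains at least as many elements of \<open>S\<close> as of its complement. The
  proof is an induction on \<open>n\<close> that splits off the last variable. To make it work, ballot sets are
  filtered by the excess \<open>d\<close> of elements over non-elements, and the degrees \<open>k\<close> strictly between
  \<open>(n - d) / 2\<close> and \<open>(n + d) / 2\<close>, which have more monomials than there are sets, are left out
  (\<open>level_sum_ballot_sets_zero_imp_zero\<close>). The excess of a ballot set is always at least \<open>n mod 2\<close>; for
  \<open>d = n mod 2\<close> no degree is left out, and Pascal's rule bounds the number of sets by \<open>N\<close>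
  (\<open>card_ballot_sets_le\<close>).

  For sharpness, \<open>k = n - n div 2\<close> is at least 2, and there are \<open>N\<close> squarefree monomials of degree \<open>k\<close>.
  Fewer than \<open>N\<close> directions impose fewer than \<open>N\<close> homogeneous linear conditions on the coefficients of
  a form of degree \<open>k\<close>, and over a nonzero commutative ring such a system has a nonzero solution
  (\<open>underdetermined_system\<close>).
\<close>

section \<open>Ballot sets determine homogeneous multilinear forms\<close>

text \<open>
  The value at the indicator vector of a finite set \<open>S\<close> of the squarefree form of degree \<open>k\<close> with
  coefficients \<open>a\<close>: exactly the monomials supported in \<open>S\<close> survive there.
\<close>

definition level_sum :: "nat \<Rightarrow> (nat set \<Rightarrow> 'a::comm_monoid_add) \<Rightarrow> nat set \<Rightarrow> 'a" where
  "level_sum k a S = (\<Sum>J | J \<subseteq> S \<and> card J = k. a J)"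

text \<open>
  Reading \<open>0, \<dots>, n - 1\<close> as the votes of an election in which the votes in \<open>S\<close> are for the first
  candidate, the first candidate never trails and wins by at least \<open>d\<close>.
\<close>

definition ballot_sets :: "nat \<Rightarrow> nat \<Rightarrow> nat set set" where
  "ballot_sets n d =
     {S. S \<subseteq> {..<n} \<and> (\<forall>m\<le>n. m \<le> 2 * card (S \<inter> {..<m})) \<and> n + d \<le> 2 * card S}"

lemma ballot_sets_subset: "S \<in> ballot_sets n d \<Longrightarrow> S \<subseteq> {..<n}"
  by (simp add: ballot_sets_def)

lemma finite_ballot_sets: "finite (ballot_sets n d)"
  by (rule finite_subset[of _ "Pow {..<n}"]) (auto simp: ballot_sets_def)

lemma ballot_sets_antimono: "d \<le> e \<Longrightarrow> ballot_sets n e \<subseteq> ballot_sets n d"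
  by (auto simp: ballot_sets_def)

lemma lessThan_in_ballot_sets:
  assumes "d \<le> n"
  shows "{..<n} \<in> ballot_sets n d"
proof -
  have "{..<n} \<inter> {..<m} = {..<m}" if "m \<le> n" for m
    using that by auto
  then show ?thesis
    using assms by (simp add: ballot_sets_def)
qed

text \<open>
  With truncated subtraction the case \<open>d = 0\<close> is included: adding a vote to a ballot set of excess at
  least 0 gives one of excess at least 0.
\<close>

lemma ballot_sets_Suc_insert:
  assumes S: "S \<in> ballot_sets n (d - 1)"
  shows "insert n S \<in> ballot_sets (Suc n) d"
proof -
  have sub: "S \<subseteq> {..<n}" and pre: "\<And>m. m \<le> n \<Longrightarrow> m \<le> 2 * card (S \<inter> {..<m})"
    and tot: "n + (d - 1) \<le> 2 * card S"
    using S by (auto simp: ballot_sets_def)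
  have fin: "finite S" and nS: "n \<notin> S"
    using sub finite_subset by auto
  have "insert n S \<inter> {..<m} = S \<inter> {..<m}" if "m \<le> n" for m
    using that by auto
  moreover have "insert n S \<inter> {..<Suc n} = insert n S"
    using sub by auto
  ultimately show ?thesis
    using sub pre tot fin nS by (auto simp: ballot_sets_def le_Suc_eq)
qed

lemma ballot_sets_Suc_mono:
  assumes S: "S \<in> ballot_sets n (Suc d)"
  shows "S \<in> ballot_sets (Suc n) d"
proof -
  have "S \<inter> {..<Suc n} = S"
    using S by (auto simp: ballot_sets_def)
  then show ?thesis
    using S by (auto simp: ballot_sets_def le_Suc_eq)
qed

text \<open>
  For \<open>d = 0\<close> the parity assumption makes \<open>n\<close> odd, so a ballot set on the first \<open>n\<close> votes cannot have
  excess 0. This is why removing the last vote leaves excess at least 1 in that case.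
\<close>

lemma ballot_sets_Suc_cover:
  assumes par: "even (Suc n + d)"
  shows "ballot_sets (Suc n) d \<subseteq>
    insert n ` ballot_sets n (if d = 0 then 1 else d - 1) \<union> ballot_sets n (Suc d)"
proof
  fix T assume T: "T \<in> ballot_sets (Suc n) d"
  have sub: "T \<subseteq> {..<Suc n}" and tot: "Suc n + d \<le> 2 * card T"
    and pre: "\<And>m. m \<le> n \<Longrightarrow> m \<le> 2 * card (T \<inter> {..<m})"
    using T by (auto simp: ballot_sets_def)
  have fin: "finite T"
    using sub finite_subset by blast
  show "T \<in> insert n ` ballot_sets n (if d = 0 then 1 else d - 1) \<union> ballot_sets n (Suc d)"
  proof (cases "n \<in> T")
    case True
    define S where "S = T - {n}"
    have c: "card T = Suc (card S)"
      using fin True by (metis S_def card.remove)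
    have "S \<inter> {..<m} = T \<inter> {..<m}" if "m \<le> n" for m
      using that by (auto simp: S_def)
    moreover have "S \<subseteq> {..<n}"
      using sub by (auto simp: S_def less_Suc_eq)
    moreover have "T \<inter> {..<n} = S"
      using sub by (auto simp: S_def less_Suc_eq)
    then have "n \<le> 2 * card S"
      using pre[of n] by simp
    then have "n + (if d = 0 then 1 else d - 1) \<le> 2 * card S"
    proof (cases "d = 0")
      case True
      then have "n \<noteq> 2 * card S"
        using par by auto
      then show ?thesis
        using \<open>n \<le> 2 * card S\<close> True by simp
    next
      case False
      then show ?thesis
        using tot c by simp
    qed
    ultimately have "S \<in> ballot_sets n (if d = 0 then 1 else d - 1)"
      using pre by (simp add: ballot_sets_def)
    moreover have "T = insert n S"
      using True by (auto simp: S_def)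
    ultimately show ?thesis by blast
  next
    case False
    then have "T \<subseteq> {..<n}"
      using sub by (auto simp: less_Suc_eq)
    then show ?thesis
      using pre tot by (simp add: ballot_sets_def)
  qed
qed

text \<open>
  Splitting a form as \<open>g = g' + x * h\<close> with \<open>g'\<close> and \<open>h\<close> free of the variable \<open>x\<close>, evaluated at \<open>x = 1\<close>.
\<close>

lemma level_sum_insert:
  fixes a :: "nat set \<Rightarrow> 'a::comm_monoid_add"
  assumes "finite S" "x \<notin> S"
  shows "level_sum (Suc k) a (insert x S) = level_sum (Suc k) a S + level_sum k (\<lambda>J. a (insert x J)) S"
proof -
  let ?A = "{J. J \<subseteq> S \<and> card J = Suc k}" and ?B = "{J. J \<subseteq> S \<and> card J = k}"
  have fin: "finite J" if "J \<subseteq> S" for J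
    using that assms(1) finite_subset by blast
  have "{J. J \<subseteq> insert x S \<and> card J = Suc k} = ?A \<union> insert x ` ?B"
  proof (intro equalityI subsetI)
    fix J assume J: "J \<in> {J. J \<subseteq> insert x S \<and> card J = Suc k}"
    show "J \<in> ?A \<union> insert x ` ?B"
    proof (cases "x \<in> J")
      case True
      have "J - {x} \<in> ?B"
        using J True by auto
      moreover have "J = insert x (J - {x})"
        using True by auto
      ultimately show ?thesis by blast
    qed (use J in auto)
  next
    fix J assume "J \<in> ?A \<union> insert x ` ?B"
    moreover have "card (insert x K) = Suc (card K)" if "K \<subseteq> S" for K
      using fin[OF that] that assms(2) by (subst card_insert_disjoint) auto
    ultimately show "J \<in> {J. J \<subseteq> insert x S \<and> card J = Suc k}"
      by auto
  qed
  moreover have "inj_on (insert x) ?B"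
    by (rule inj_onI) (metis (no_types, lifting) Diff_insert_absorb assms(2) mem_Collect_eq subsetD)
  moreover have "?A \<inter> insert x ` ?B = {}"
    using assms(2) by auto
  ultimately show ?thesis
    unfolding level_sum_def using assms(1)
    by (simp add: sum.union_disjoint sum.reindex)
qed

lemma level_sum_zero:
  assumes "finite S"
  shows "level_sum 0 a S = a {}"
proof -
  have "{J. J \<subseteq> S \<and> card J = 0} = {{}}"
    using assms by (auto dest: finite_subset)
  then show ?thesis by (simp add: level_sum_def)
qed

lemma level_sum_eq_0: "(\<And>J. J \<subseteq> S \<Longrightarrow> card J = k \<Longrightarrow> a J = 0) \<Longrightarrow> level_sum k a S = 0"
  unfolding level_sum_def by (rule sum.neutral) auto

text \<open>
  A squarefree form of degree \<open>k\<close> that vanishes on the ballot sets of excess at least \<open>d\<close> is zero, unless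
  \<open>k\<close> lies strictly between \<open>(n - d) / 2\<close> and \<open>(n + d) / 2\<close>. Write the form in \<open>n + 1\<close> variables as
  \<open>g + x h\<close>, where \<open>x\<close> is the last variable. Ballot sets that omit the last vote show that \<open>g\<close> vanishes at
  excess \<open>d + 1\<close>, and those that contain it show that \<open>g + h\<close> vanishes at excess \<open>d - 1\<close>. If \<open>k\<close> is large,
  the induction hypothesis applies to \<open>g\<close> at \<open>d + 1\<close>, and then to \<open>h\<close> at \<open>d - 1\<close>. If \<open>k\<close> is small, it need
  not apply to \<open>g\<close> at \<open>d + 1\<close>; but sets of excess \<open>d + 1\<close> are among those of excess \<open>d - 1\<close>, so \<open>h\<close>, whose
  degree is smaller by one, vanishes on them and is zero, and then \<open>g\<close> is zero by the hypothesis at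
  \<open>d - 1\<close>.
\<close>

lemma level_sum_ballot_sets_zero_imp_zero:
  fixes a :: "nat set \<Rightarrow> 'a::ab_group_add"
  assumes "even (n + d)" "2 * k + d \<le> n \<or> n + d \<le> 2 * k"
    and "\<And>S. S \<in> ballot_sets n d \<Longrightarrow> level_sum k a S = 0"
    and "J \<subseteq> {..<n}" "card J = k"
  shows "a J = 0"
  using assms
proof (induction n arbitrary: d k a J)
  case 0
  then have "J = {}" "k = 0" "d = 0" by auto
  then show ?case
    using "0.prems"(3)[OF lessThan_in_ballot_sets] by (simp add: level_sum_zero)
next
  case (Suc n)
  show ?case
  proof (cases k)
    case 0
    moreover have "finite J"
      using Suc.prems(4) finite_subset by blast
    ultimately have "d \<le> Suc n" "J = {}"
      using Suc.prems by auto
    then show ?thesis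
      using Suc.prems(3)[OF lessThan_in_ballot_sets] 0 by (simp add: level_sum_zero)
  next
    case (Suc k')
    define b where "b = (\<lambda>J. a (insert n J))"
    \<comment> \<open>For \<open>d = 0\<close> the number \<open>n\<close> is odd, so that a ballot set always has excess at least 1.\<close>
    define e where "e = (if d = 0 then 1 else d - 1)"
    have fin: "finite S" "n \<notin> S" if "S \<in> ballot_sets n d'" for S d'
      using ballot_sets_subset[OF that] finite_subset by auto
    have without: "level_sum k a S = 0" if "S \<in> ballot_sets n (Suc d)" for S
      using that by (intro Suc.prems(3) ballot_sets_Suc_mono)
    have both: "level_sum k a S + level_sum k' b S = 0" if "S \<in> ballot_sets n e" for S
    proof -
      have "S \<in> ballot_sets n (d - 1)"
        using that ballot_sets_antimono[of "d - 1" e] by (auto simp: e_def split: if_splits)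
      then show ?thesis
        using Suc.prems(3)[OF ballot_sets_Suc_insert, of S] level_sum_insert[OF fin[OF that], of k' a]
        by (simp add: Suc b_def)
    qed
    have pe: "even (n + e)" "even (n + Suc d)"
      using Suc.prems(1) by (auto simp: e_def)
    have ab: "(\<forall>K. K \<subseteq> {..<n} \<longrightarrow> card K = k \<longrightarrow> a K = 0) \<and>
      (\<forall>K. K \<subseteq> {..<n} \<longrightarrow> card K = k' \<longrightarrow> b K = 0)"
      using Suc.prems(2)
    proof
      assume le: "2 * k + d \<le> Suc n"
      have b_lev: "level_sum k' b S = 0" if "S \<in> ballot_sets n (Suc d)" for S
      proof -
        have "S \<in> ballot_sets n e"
          by (rule subsetD[OF ballot_sets_antimono that]) (auto simp: e_def)
        then show ?thesis
          using both[of S] without[OF that] by simp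
      qed
      have "2 * k' + Suc d \<le> n \<or> n + Suc d \<le> 2 * k'"
        using le Suc by simp
      then have b0: "b K = 0" if "K \<subseteq> {..<n}" "card K = k'" for K
        using Suc.IH[OF pe(2) _ b_lev that] by blast
      have a_lev: "level_sum k a S = 0" if "S \<in> ballot_sets n e" for S
        using both[OF that] level_sum_eq_0[of S k' b] b0 ballot_sets_subset[OF that] by auto
      have "2 * k + e \<le> n \<or> n + e \<le> 2 * k"
        using le pe unfolding e_def by presburger
      then have "a K = 0" if "K \<subseteq> {..<n}" "card K = k" for K
        using Suc.IH[OF pe(1) _ a_lev that] by blast
      with b0 show ?thesis by blast
    next
      assume le: "Suc n + d \<le> 2 * k"
      then have "2 * k + Suc d \<le> n \<or> n + Suc d \<le> 2 * k"
        by simp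
      then have a0: "a K = 0" if "K \<subseteq> {..<n}" "card K = k" for K
        using Suc.IH[OF pe(2) _ without that] by blast
      have b_lev: "level_sum k' b S = 0" if "S \<in> ballot_sets n e" for S
        using both[OF that] level_sum_eq_0[of S k a] a0 ballot_sets_subset[OF that] by auto
      have "2 * k' + e \<le> n \<or> n + e \<le> 2 * k'"
        using le pe Suc unfolding e_def by presburger
      then have "b K = 0" if "K \<subseteq> {..<n}" "card K = k'" for K
        using Suc.IH[OF pe(1) _ b_lev that] by blast
      with a0 show ?thesis by blast
    qed
    show ?thesis
    proof (cases "n \<in> J")
      case True
      have "J - {n} \<subseteq> {..<n}" "card (J - {n}) = k'"
        using True Suc.prems(4,5) Suc by auto
      then have "b (J - {n}) = 0"
        using ab by blast
      then show ?thesis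
        using True by (simp add: b_def insert_absorb)
    next
      case False
      then have "J \<subseteq> {..<n}"
        using Suc.prems(4) by (auto simp: less_Suc_eq)
      then show ?thesis
        using ab Suc.prems(5) by blast
    qed
  qed
qed

lemma ballot_sets_empty:
  assumes "n < d"
  shows "ballot_sets n d = {}"
proof -
  have card_le: "card S \<le> n" if "S \<subseteq> {..<n}" for S
    using card_mono[OF _ that] by simp
  have "2 * card S < n + d" if "S \<subseteq> {..<n}" for S
    using assms card_le[OF that] by linarith
  then show ?thesis
    unfolding ballot_sets_def by (auto simp: not_le)
qed

text \<open>
  The recursion on the last vote is Pascal's rule. For \<open>d = 0\<close> both summands are the binomial
  coefficient of \<open>n\<close> over \<open>(n - 1) / 2\<close>, and the symmetry of the odd row \<open>n\<close> brings them into the form of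
  Pascal's rule.
\<close>

lemma card_ballot_sets_le:
  assumes "even (n + d)"
  shows "card (ballot_sets n d) \<le> n choose ((n - d) div 2)"
  using assms
proof (induction n arbitrary: d)
  case 0
  show ?case
  proof (cases "d = 0")
    case True
    have "ballot_sets 0 0 \<subseteq> {{}}" by (auto simp: ballot_sets_def)
    then show ?thesis
      using True card_mono[of "{{}}" "ballot_sets 0 0"] by simp
  qed (simp add: ballot_sets_empty)
next
  case (Suc n)
  define e where "e = (if d = 0 then 1 else d - 1)"
  have pe: "even (n + e)" "even (n + Suc d)"
    using Suc.prems by (auto simp: e_def)
  have "card (ballot_sets (Suc n) d) \<le> card (insert n ` ballot_sets n e \<union> ballot_sets n (Suc d))"
    unfolding e_def
    by (rule card_mono[OF _ ballot_sets_Suc_cover[OF Suc.prems]]) (simp add: finite_ballot_sets)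
  also have "\<dots> \<le> card (ballot_sets n e) + card (ballot_sets n (Suc d))"
    by (rule order_trans[OF card_Un_le]) (simp add: card_image_le finite_ballot_sets)
  finally have step: "card (ballot_sets (Suc n) d) \<le>
    card (ballot_sets n e) + card (ballot_sets n (Suc d))" .
  also have "\<dots> \<le> (n choose ((n - e) div 2)) + (n choose ((n - Suc d) div 2))"
    using Suc.IH[OF pe(1)] Suc.IH[OF pe(2)] by (rule add_mono)
  finally have bound: "card (ballot_sets (Suc n) d) \<le>
    (n choose ((n - e) div 2)) + (n choose ((n - Suc d) div 2))" .
  consider "d = 0" | "0 < d" "d < n" | "n \<le> d" by linarith
  then show ?case
  proof cases
    case 1
    then obtain j where n: "n = 2 * j + 1"
      using pe by (auto elim!: oddE)
    have "n choose j = n choose (Suc j)"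
    proof -
      have "j \<le> n" "n - j = Suc j"
        using n by simp_all
      then show ?thesis
        using binomial_symmetric[of j n] by metis
    qed
    then have "Suc n choose Suc j = (n choose j) + (n choose j)"
      by (simp only: binomial_Suc_Suc)
    moreover have "(n - e) div 2 = j" "(n - Suc d) div 2 = j" "(Suc n - d) div 2 = Suc j"
      using n 1 by (simp_all add: e_def)
    ultimately show ?thesis
      using bound by (simp only:)
  next
    case 2
    then have "even (n - Suc d)"
      using pe(2) by (simp add: even_diff_nat)
    then obtain j where "n - Suc d = 2 * j"
      by (rule evenE)
    then have n: "n = 2 * j + Suc d"
      using 2 by simp
    then have "(n - e) div 2 = Suc j" "(n - Suc d) div 2 = j" "(Suc n - d) div 2 = Suc j"
      using 2 by (simp_all add: e_def)
    moreover have "Suc n choose Suc j = (n choose j) + (n choose Suc j)"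
      by (rule binomial_Suc_Suc)
    ultimately show ?thesis
      using bound by (simp only:)
  next
    case 3
    then have "card (ballot_sets n (Suc d)) = 0"
      by (simp add: ballot_sets_empty)
    moreover have "(n - e) div 2 = 0"
      using 3 by (auto simp: e_def)
    then have "card (ballot_sets n e) \<le> 1"
      using Suc.IH[OF pe(1)] by simp
    moreover have "0 < Suc n choose ((Suc n - d) div 2)"
      by (rule zero_less_binomial) linarith
    ultimately show ?thesis
      using step by linarith
  qed
qed

section \<open>Polynomials that vanish on a Vandermonde full ring\<close>

text \<open>
  Up to sign the multiplier is the Vandermonde determinant of the nodes \<open>r j\<close>, so this is Cramer's rule. The induction
  avoids determinants: dividing \<open>q\<close> by \<open>x - r n\<close> leaves a quotient \<open>h\<close>, and \<open>h\<close> vanishes at the remaining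
  nodes after it is multiplied by the product \<open>D\<close> of all the differences \<open>r j - r n\<close>.
\<close>

lemma vandermonde_smult_zero:
  fixes q :: "'a::comm_ring_1 poly" and r :: "nat \<Rightarrow> 'a"
  assumes "\<And>i. n \<le> i \<Longrightarrow> coeff q i = 0" "\<And>j. j < n \<Longrightarrow> poly q (r j) = 0"
  shows "smult (\<Prod>(j, k)\<in>{(j, k). j < k \<and> k < n}. r j - r k) q = 0"
  using assms
proof (induction n arbitrary: q)
  case 0
  then have "q = 0" by (simp add: poly_eq_iff)
  then show ?case by simp
next
  case (Suc n)
  define h where "h = synthetic_div q (r n)"
  define D where "D = (\<Prod>j<n. r j - r n)"
  define V where "V = (\<Prod>(j, k)\<in>{(j, k). j < k \<and> k < n}. r j - r k)"
  have q: "q = pCons 0 h - smult (r n) h"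
    using synthetic_div_correct[of q "r n"] Suc.prems(2)[of n] by (simp add: h_def algebra_simps)
  have deg: "degree q \<le> n"
    by (rule degree_le) (use Suc.prems(1) in auto)
  have hi: "coeff h i = 0" if "n \<le> i" for i
  proof (cases "n = 0")
    case True
    then show ?thesis
      using deg by (simp add: h_def synthetic_div_eq_0_iff[THEN iffD2])
  next
    case False
    then show ?thesis
      using deg that by (intro coeff_eq_0) (simp add: h_def degree_synthetic_div)
  qed
  have "poly (smult D h) (r j) = 0" if "j < n" for j
  proof -
    have "(r j - r n) * poly h (r j) = 0"
      using Suc.prems(2)[of j] that by (simp add: q algebra_simps)
    moreover have "D = (\<Prod>i\<in>{..<n} - {j}. r i - r n) * (r j - r n)"
      unfolding D_def using that by (subst prod.remove[of _ j]) (auto simp: mult.commute)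
    ultimately show ?thesis
      by (simp add: mult.assoc)
  qed
  then have VD: "smult (V * D) h = 0"
    using Suc.IH[of "smult D h"] hi by (simp add: V_def)
  have set: "{(j, k). j < k \<and> k < Suc n} = {(j, k). j < k \<and> k < n} \<union> (\<lambda>j. (j, n)) ` {..<n}"
    by (auto simp: less_Suc_eq)
  have fin: "finite {(j, k). j < k \<and> k < n}"
    by (rule finite_subset[of _ "{..<n} \<times> {..<n}"]) auto
  have "(\<Prod>(j, k)\<in>{(j, k). j < k \<and> k < Suc n}. r j - r k) = V * D"
    unfolding set V_def D_def
    by (subst prod.union_disjoint) (use fin in \<open>auto simp: prod.reindex inj_on_def\<close>)
  moreover have "smult (V * D) q = pCons 0 (smult (V * D) h) - smult (r n) (smult (V * D) h)"
    by (subst q) (simp add: smult_diff_right mult.commute)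
  ultimately show ?case
    using VD by simp
qed

text \<open>
  The factor \<open>\<Prod>j. x\<^sub>j\<close> of the Vandermonde value absorbs the factor \<open>r\<close> of the vanishing polynomial
  \<open>r * q r\<close>; the differences do the rest. Hence every coefficient of \<open>q\<close> annihilates all Vandermonde
  values.
\<close>

lemma vandermonde_full_poly_zero:
  fixes q :: "'a::comm_ring_1 poly"
  assumes full: "vandermonde_full TYPE('a) n"
    and deg: "\<And>i. n \<le> i \<Longrightarrow> coeff q i = 0"
    and zero: "\<And>r. r * poly q r = 0"
  shows "q = 0"
proof -
  have "coeff q i * vandermonde_value n r = 0" for i r
  proof -
    have "poly (smult (\<Prod>j<n. r $ j) q) (r $ j) = 0" if "j < n" for j
    proof -
      have "(\<Prod>j<n. r $ j) = (\<Prod>i\<in>{..<n} - {j}. r $ i) * r $ j"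
        using that by (subst prod.remove[of _ j]) (auto simp: mult.commute)
      then show ?thesis
        using zero[of "r $ j"] by (simp add: mult.assoc)
    qed
    then have "smult (\<Prod>(j, k)\<in>{(j, k). j < k \<and> k < n}. r $ j - r $ k) (smult (\<Prod>j<n. r $ j) q) = 0"
      by (intro vandermonde_smult_zero) (use deg in auto)
    then have "coeff (smult (vandermonde_value n r) q) i = 0"
      by (simp add: vandermonde_value_def mult.commute)
    then show ?thesis
      by (simp add: mult.commute)
  qed
  then have "coeff q i = 0" for i
    using full[unfolded vandermonde_full_iff] by blast
  then show ?thesis
    by (simp add: poly_eq_iff)
qed

section \<open>Multi-affine maps along lines\<close>

definition level_form :: "nat \<Rightarrow> nat \<Rightarrow> (nat set \<Rightarrow> 'a::comm_ring_1) \<Rightarrow> 'a vec \<Rightarrow> 'a" where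
  "level_form n k a v = (\<Sum>J | J \<subseteq> {..<n} \<and> card J = k. a J * (\<Prod>j\<in>J. v $ j))"

lemma multi_affine_on_line:
  fixes a :: "nat set \<Rightarrow> 'a::comm_ring_1"
  assumes f: "\<forall>x\<in>carrier_vec n. f x = (\<Sum>J\<in>Pow {..<n}. a J * (\<Prod>j\<in>J. x $ j))"
    and v: "v \<in> carrier_vec n"
  shows "f (r \<cdot>\<^sub>v v) = (\<Sum>k\<le>n. level_form n k a v * r ^ k)"
proof -
  have "f (r \<cdot>\<^sub>v v) = (\<Sum>J\<in>Pow {..<n}. a J * (\<Prod>j\<in>J. (r \<cdot>\<^sub>v v) $ j))"
    using f v by simp
  also have "\<dots> = (\<Sum>J\<in>Pow {..<n}. a J * (\<Prod>j\<in>J. v $ j) * r ^ card J)"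
  proof (rule sum.cong)
    fix J assume "J \<in> Pow {..<n}"
    then have "(\<Prod>j\<in>J. (r \<cdot>\<^sub>v v) $ j) = (\<Prod>j\<in>J. r * v $ j)"
      using v by (intro prod.cong) auto
    then show "a J * (\<Prod>j\<in>J. (r \<cdot>\<^sub>v v) $ j) = a J * (\<Prod>j\<in>J. v $ j) * r ^ card J"
      by (simp add: prod.distrib mult_ac)
  qed simp
  also have "\<dots> = (\<Sum>k\<le>n. \<Sum>J | J \<in> Pow {..<n} \<and> card J = k. a J * (\<Prod>j\<in>J. v $ j) * r ^ card J)"
    by (rule sum.group[symmetric]) (use card_mono[of "{..<n}"] in auto)
  also have "\<dots> = (\<Sum>k\<le>n. level_form n k a v * r ^ k)"
    unfolding level_form_def by (intro sum.cong) (auto simp: sum_distrib_right)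
  finally show ?thesis .
qed

text \<open>
  Affine-linearity with slope \<open>m\<close> says that \<open>r * (c 1 - m + c 2 * r + \<dots> + c n * r ^ (n - 1))\<close> vanishes
  for all \<open>r\<close>, where \<open>c k\<close> is the value at \<open>v\<close> of the form of degree \<open>k\<close>. The second factor has \<open>n\<close>
  coefficients, which is the number that Vandermonde fullness can kill.
\<close>

lemma affine_linear_along_iff_level_forms:
  fixes a :: "nat set \<Rightarrow> 'a::comm_ring_1"
  assumes full: "vandermonde_full TYPE('a) n"
    and f: "\<forall>x\<in>carrier_vec n. f x = (\<Sum>J\<in>Pow {..<n}. a J * (\<Prod>j\<in>J. x $ j))"
    and v: "v \<in> carrier_vec n" and n: "1 \<le> n"
  shows "affine_linear_along n f v \<longleftrightarrow> (\<forall>k\<in>{2..n}. level_form n k a v = 0)"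
proof -
  define c where "c k = level_form n k a v" for k
  have "f (0\<^sub>v n) = f (0 \<cdot>\<^sub>v v)"
    using v by (intro arg_cong[of _ _ f]) auto
  also have "\<dots> = c 0"
    unfolding multi_affine_on_line[OF f v] c_def by (simp add: power_0_left if_distrib cong: if_cong)
  finally have f0: "f (0\<^sub>v n) = c 0" .
  have line: "f (r \<cdot>\<^sub>v v) = f (0\<^sub>v n) + r * (\<Sum>k<n. c (Suc k) * r ^ k)" for r
    unfolding multi_affine_on_line[OF f v] f0 c_def
    by (simp add: sum.atMost_shift sum_distrib_left mult_ac)
  show ?thesis
  proof
    assume "affine_linear_along n f v"
    then obtain m where m: "\<And>r. f (r \<cdot>\<^sub>v v) = f (0\<^sub>v n) + r * m"
      unfolding affine_linear_along_def by blast
    define q where "q = (\<Sum>k<n. monom (c (Suc k)) k) - monom m 0"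
    have "r * poly q r = 0" for r
      using line[of r] m[of r] by (simp add: q_def poly_sum poly_monom algebra_simps)
    then have "q = 0"
      by (intro vandermonde_full_poly_zero[OF full]) (use n in \<open>auto simp: q_def coeff_sum\<close>)
    have "c k = 0" if "k \<in> {2..n}" for k
    proof -
      have "coeff q (k - 1) = c k"
        using that n by (auto simp: q_def coeff_sum)
      then show ?thesis
        using \<open>q = 0\<close> by simp
    qed
    then show "\<forall>k\<in>{2..n}. level_form n k a v = 0"
      by (simp add: c_def)
  next
    assume "\<forall>k\<in>{2..n}. level_form n k a v = 0"
    then have "c (Suc k) * r ^ k = (if k = 0 then c 1 else 0)" if "k < n" for k r
      using that by (auto simp: c_def)
    then have "f (r \<cdot>\<^sub>v v) = f (0\<^sub>v n) + r * c 1" for r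
      using n by (simp add: line)
    then show "affine_linear_along n f v"
      unfolding affine_linear_along_def by blast
  qed
qed

lemma affine_linear_if_coeffs_zero:
  fixes a :: "nat set \<Rightarrow> 'a::comm_ring_1"
  assumes f: "\<forall>x\<in>carrier_vec n. f x = (\<Sum>J\<in>Pow {..<n}. a J * (\<Prod>j\<in>J. x $ j))"
    and zero: "\<And>J. J \<subseteq> {..<n} \<Longrightarrow> 2 \<le> card J \<Longrightarrow> a J = 0"
  shows "affine_linear n f"
proof -
  have val: "f x = a {} + (\<Sum>i<n. a {i} * x $ i)" if "x \<in> carrier_vec n" for x
  proof -
    let ?S = "insert {} ((\<lambda>i. {i}) ` {..<n})"
    have "a J = 0" if "J \<in> Pow {..<n} - ?S" for J
    proof (rule zero)
      show "J \<subseteq> {..<n}" using that by auto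
      then have "finite J" using finite_subset by blast
      moreover have "card J \<noteq> 1"
        using that by (auto simp: card_1_singleton_iff)
      ultimately show "2 \<le> card J"
        using that by (cases "card J"; cases "card J - 1") auto
    qed
    then have "(\<Sum>J\<in>Pow {..<n}. a J * (\<Prod>j\<in>J. x $ j)) = (\<Sum>J\<in>?S. a J * (\<Prod>j\<in>J. x $ j))"
      by (intro sum.mono_neutral_right) auto
    also have "\<dots> = a {} + (\<Sum>i<n. a {i} * x $ i)"
      by (subst sum.insert) (auto simp: sum.reindex)
    finally show ?thesis
      using f that by simp
  qed
  have "f c = f (0\<^sub>v n) + (\<Sum>i<n. a {i} * c $ i)" if "c \<in> carrier_vec n" for c
    using val[OF that] val[of "0\<^sub>v n"] by simp
  then show ?thesis
    unfolding affine_linear_def by (intro exI[of _ "\<lambda>i. a {i}"]) blast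
qed

definition indicator_vec :: "nat \<Rightarrow> nat set \<Rightarrow> 'a::comm_ring_1 vec" where
  "indicator_vec n S = vec n (\<lambda>i. if i \<in> S then 1 else 0)"

lemma indicator_vec_carrier: "indicator_vec n S \<in> carrier_vec n"
  by (simp add: indicator_vec_def)

lemma level_form_indicator_vec:
  assumes "S \<subseteq> {..<n}"
  shows "level_form n k a (indicator_vec n S) = level_sum k a S"
proof -
  have mon: "(\<Prod>j\<in>J. indicator_vec n S $ j) = (if J \<subseteq> S then 1 else 0 :: 'a)" if "J \<subseteq> {..<n}" for J
  proof -
    have fin: "finite J" using that finite_subset by blast
    have "(\<Prod>j\<in>J. indicator_vec n S $ j) = (\<Prod>j\<in>J. if j \<in> S then 1 else 0 :: 'a)"
      using that by (intro prod.cong) (auto simp: indicator_vec_def)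
    also have "\<dots> = (if J \<subseteq> S then 1 else 0)"
    proof (cases "J \<subseteq> S")
      case True
      then show ?thesis by (auto intro!: prod.neutral)
    next
      case False
      then show ?thesis by (auto intro!: prod_zero fin)
    qed
    finally show ?thesis .
  qed
  have "level_form n k a (indicator_vec n S) = (\<Sum>J | J \<subseteq> {..<n} \<and> card J = k. if J \<subseteq> S then a J else 0)"
    unfolding level_form_def by (intro sum.cong) (auto simp: mon)
  also have "\<dots> = (\<Sum>J \<in> {J. J \<subseteq> {..<n} \<and> card J = k} \<inter> {J. J \<subseteq> S}. a J)"
    by (simp add: sum.inter_restrict)
  also have "{J. J \<subseteq> {..<n} \<and> card J = k} \<inter> {J. J \<subseteq> S} = {J. J \<subseteq> S \<and> card J = k}"
    using assms by auto
  finally show ?thesis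
    by (simp add: level_sum_def)
qed

section \<open>Underdetermined linear systems over commutative rings\<close>

text \<open>
  If finitely many elements are nilpotent modulo a proper ideal
  \<open>K\<close>, then some \<open>b\<close> that is nonzero modulo \<open>K\<close> kills them all modulo \<open>K\<close>. For one further element \<open>c\<close>,
  multiply \<open>b\<close> by the last power of \<open>c\<close> that keeps the product outside \<open>K\<close>.
\<close>

lemma common_annihilator_of_nilpotents:
  fixes K :: "'a::comm_ring_1 set"
  assumes mult: "\<And>x r. x \<in> K \<Longrightarrow> r * x \<in> K" and one: "1 \<notin> K" and "finite J"
    and nil: "\<And>j. j \<in> J \<Longrightarrow> \<exists>e::nat. c j ^ e \<in> K"
  shows "\<exists>b. b \<notin> K \<and> (\<forall>j\<in>J. b * c j \<in> K)"
  using \<open>finite J\<close> nil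
proof (induction J rule: finite_induct)
  case empty
  show ?case using one by blast
next
  case (insert i J)
  then obtain b where b: "b \<notin> K" "\<forall>j\<in>J. b * c j \<in> K" by auto
  obtain e where e: "c i ^ e \<in> K" using insert.prems by blast
  define t where "t = (LEAST t. b * c i ^ t \<in> K)"
  have t: "b * c i ^ t \<in> K"
    unfolding t_def by (rule LeastI[of _ e]) (use mult e in blast)
  obtain s where s: "t = Suc s"
    using t b(1) by (cases t) auto
  have "b * c i ^ s \<notin> K"
    using not_less_Least[of s "\<lambda>t. b * c i ^ t \<in> K"] s by (auto simp: t_def)
  moreover have "b * c i ^ s * c i \<in> K"
    using t s by (simp add: mult_ac)
  moreover have "b * c i ^ s * c j \<in> K" if "j \<in> J" for j
    using mult[of "b * c j" "c i ^ s"] b(2) that by (simp add: mult_ac)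
  ultimately show ?case by blast
qed

text \<open>
  Gaussian elimination on the last equation, by induction on the number of equations. Working modulo an
  arbitrary proper ideal \<open>K\<close> allows the induction to change the ring. If some coefficient \<open>c\<close> of the last
  equation is not nilpotent modulo \<open>K\<close>, it becomes a non-zero-divisor modulo the ideal of all elements
  that a power of \<open>c\<close> moves into \<open>K\<close>; modulo that ideal its variable can be eliminated, and a solution
  is brought back to \<open>K\<close> by multiplying it with a power of \<open>c\<close>. Otherwise some \<open>b\<close> outside \<open>K\<close> moves all
  coefficients of the last equation into \<open>K\<close>. Then that equation holds automatically for multiples of
  \<open>b\<close>, and the other equations are solved modulo the ideal of all \<open>x\<close> with \<open>b * x\<close> in \<open>K\<close>.
\<close>

lemma underdetermined_system_mod_ideal:
  fixes A :: "nat \<Rightarrow> 'b \<Rightarrow> 'a::comm_ring_1" and K :: "'a set"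
  assumes "0 \<in> K" "\<And>x y. x \<in> K \<Longrightarrow> y \<in> K \<Longrightarrow> x + y \<in> K"
    and "\<And>x r. x \<in> K \<Longrightarrow> r * x \<in> K" "1 \<notin> K"
    and "finite J" "m < card J"
  shows "\<exists>x. (\<exists>j\<in>J. x j \<notin> K) \<and> (\<forall>i<m. (\<Sum>j\<in>J. A i j * x j) \<in> K)"
  using assms
proof (induction m arbitrary: A J K)
  case 0
  then have "J \<noteq> {}" by auto
  then show ?case
    using "0.prems"(4) by (intro exI[of _ "\<lambda>_. 1"]) auto
next
  case (Suc m)
  note zero = Suc.prems(1) and add = Suc.prems(2) and mult = Suc.prems(3) and one = Suc.prems(4)
    and fin = Suc.prems(5) and card = Suc.prems(6)
  show ?case
  proof (cases "\<forall>j\<in>J. \<exists>e::nat. A m j ^ e \<in> K")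
    case True
    obtain b where b: "b \<notin> K" "\<forall>j\<in>J. b * A m j \<in> K"
      using common_annihilator_of_nilpotents[OF mult one fin, of "A m"] True by blast
    define L where "L = {x. b * x \<in> K}"
    have "\<exists>x. (\<exists>j\<in>J. x j \<notin> L) \<and> (\<forall>i<m. (\<Sum>j\<in>J. A i j * x j) \<in> L)"
    proof (rule Suc.IH)
      show "x + y \<in> L" if "x \<in> L" "y \<in> L" for x y
        using that add by (simp add: L_def distrib_left)
      show "r * x \<in> L" if "x \<in> L" for x r
        using that mult[of "b * x" r] by (simp add: L_def mult_ac)
    qed (use zero b fin card in \<open>auto simp: L_def\<close>)
    then obtain x where x: "\<exists>j\<in>J. b * x j \<notin> K" "\<And>i. i < m \<Longrightarrow> b * (\<Sum>j\<in>J. A i j * x j) \<in> K"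
      by (auto simp: L_def)
    have sumK: "(\<Sum>j\<in>J. g j) \<in> K" if "\<And>j. j \<in> J \<Longrightarrow> g j \<in> K" for g
      using fin that by (induction rule: finite_induct) (auto intro: zero add)
    have "(\<Sum>j\<in>J. A i j * (b * x j)) \<in> K" if "i < Suc m" for i
    proof (cases "i = m")
      case True
      show ?thesis
      proof (rule sumK)
        fix j assume "j \<in> J"
        then show "A i j * (b * x j) \<in> K"
          using mult[of "b * A m j" "x j"] b True by (simp add: mult_ac)
      qed
    next
      case False
      then show ?thesis
        using x(2)[of i] that by (simp add: sum_distrib_left mult_ac)
    qed
    then show ?thesis
      using x(1) by (intro exI[of _ "\<lambda>j. b * x j"]) blast
  next
    case False
    then obtain p where p: "p \<in> J" "\<And>e::nat. A m p ^ e \<notin> K" by blast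
    define c where "c = A m p"
    define L where "L = {x. \<exists>e::nat. c ^ e * x \<in> K}"
    define J' where "J' = J - {p}"
    have J': "finite J'" "p \<notin> J'" "J = insert p J'"
      using fin p by (auto simp: J'_def)
    have upd: "c ^ (e + d) * x \<in> K" if "c ^ e * x \<in> K" for e d x
      using mult[OF that, of "c ^ d"] by (simp add: power_add mult_ac)
    have "\<exists>y. (\<exists>j\<in>J'. y j \<notin> L) \<and>
      (\<forall>i<m. (\<Sum>j\<in>J'. (c * A i j - A i p * A m j) * y j) \<in> L)"
    proof (rule Suc.IH)
      show "x + y \<in> L" if xy: "x \<in> L" "y \<in> L" for x y
      proof -
        obtain e d where "c ^ e * x \<in> K" "c ^ d * y \<in> K"
          using xy by (auto simp: L_def)
        then have "c ^ (e + d) * x \<in> K" "c ^ (d + e) * y \<in> K"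
          using upd by blast+
        then have "c ^ (e + d) * (x + y) \<in> K"
          using add by (simp add: distrib_left add.commute)
        then show ?thesis by (auto simp: L_def)
      qed
      show "r * x \<in> L" if "x \<in> L" for x r
        using that mult by (force simp: L_def mult.left_commute)
    qed (use zero p J' card in \<open>auto simp: L_def c_def\<close>)
    then obtain y where y: "\<exists>j\<in>J'. y j \<notin> L"
      "\<And>i. i < m \<Longrightarrow> (\<Sum>j\<in>J'. (c * A i j - A i p * A m j) * y j) \<in> L"
      by blast
    \<comment> \<open>The last equation determines \<open>x p\<close> after clearing the denominator \<open>c\<close>.\<close>
    define x where "x j = (if j = p then - (\<Sum>l\<in>J'. A m l * y l) else c * y j)" for j
    have sum_x: "(\<Sum>j\<in>J. A i j * x j) = (\<Sum>j\<in>J'. (c * A i j - A i p * A m j) * y j)" for i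
    proof -
      have "(\<Sum>j\<in>J'. A i j * x j) = (\<Sum>j\<in>J'. A i j * (c * y j))"
        using J' by (intro sum.cong) (auto simp: x_def)
      then show ?thesis
        using J' by (simp add: x_def sum_distrib_left sum_subtractf algebra_simps)
    qed
    have "\<exists>e. c ^ e * (\<Sum>j\<in>J. A i j * x j) \<in> K" if "i < Suc m" for i
    proof (cases "i = m")
      case True
      then have "(\<Sum>j\<in>J. A i j * x j) = 0"
        unfolding sum_x by (simp add: c_def)
      then show ?thesis
        using zero by simp
    next
      case False
      then show ?thesis
        using y(2)[of i] that by (simp add: sum_x L_def)
    qed
    then obtain e where e: "\<And>i. i < Suc m \<Longrightarrow> c ^ e i * (\<Sum>j\<in>J. A i j * x j) \<in> K"
      by metis
    \<comment> \<open>The exponents depend on the equation; any common upper bound serves.\<close>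
    define E where "E = sum e {..<Suc m}"
    have "(\<Sum>j\<in>J. A i j * (c ^ E * x j)) \<in> K" if "i < Suc m" for i
    proof -
      have "e i \<le> E"
        unfolding E_def using that by (intro member_le_sum) auto
      then have "c ^ E * (\<Sum>j\<in>J. A i j * x j) \<in> K"
        using upd[OF e[OF that], of "E - e i"] by simp
      then show ?thesis
        by (simp add: sum_distrib_left mult_ac)
    qed
    moreover have "\<exists>j\<in>J. c ^ E * x j \<notin> K"
    proof -
      obtain j where j: "j \<in> J'" "y j \<notin> L" using y(1) by blast
      then have "c ^ Suc E * y j \<notin> K"
        unfolding L_def by blast
      then have "c ^ E * x j \<notin> K"
        using j J' by (auto simp: x_def mult_ac)
      then show ?thesis using j J' by blast
    qed
    ultimately show ?thesis
      by (intro exI[of _ "\<lambda>j. c ^ E * x j"]) blast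
  qed
qed

corollary underdetermined_system:
  fixes A :: "nat \<Rightarrow> 'b \<Rightarrow> 'a::comm_ring_1"
  assumes "finite J" "m < card J"
  obtains x where "\<exists>j\<in>J. x j \<noteq> 0" "\<And>i. i < m \<Longrightarrow> (\<Sum>j\<in>J. A i j * x j) = 0"
  using underdetermined_system_mod_ideal[of "{0}" J m A] assms by auto

section \<open>Directions that detect affine-linearity\<close>

lemma affine_linear_if_affine_linear_along_ballot_sets:
  fixes f :: "'a::comm_ring_1 vec \<Rightarrow> 'a"
  assumes n: "1 \<le> n" and full: "vandermonde_full TYPE('a) n" and f: "multi_affine n f"
    and along: "\<And>S. S \<in> ballot_sets n (n mod 2) \<Longrightarrow> affine_linear_along n f (indicator_vec n S)"
  shows "affine_linear n f"
proof -
  obtain a where a: "\<forall>x\<in>carrier_vec n. f x = (\<Sum>J\<in>Pow {..<n}. a J * (\<Prod>j\<in>J. x $ j))"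
    using f unfolding multi_affine_def by blast
  show ?thesis
  proof (rule affine_linear_if_coeffs_zero[OF a])
    fix J assume J: "J \<subseteq> {..<n}" "2 \<le> card J"
    have "card J \<le> n"
      using card_mono[OF _ J(1)] by simp
    have "level_sum (card J) a S = 0" if S: "S \<in> ballot_sets n (n mod 2)" for S
      using affine_linear_along_iff_level_forms[OF full a indicator_vec_carrier n] along[OF S]
        J(2) \<open>card J \<le> n\<close> level_form_indicator_vec[OF ballot_sets_subset[OF S]]
      by (metis atLeastAtMost_iff)
    moreover have "even (n + n mod 2)" "2 * card J + n mod 2 \<le> n \<or> n + n mod 2 \<le> 2 * card J"
      by presburger+
    ultimately show "a J = 0"
      using level_sum_ballot_sets_zero_imp_zero J(1) by blast
  qed
qed

text \<open>
  A nonzero form of degree \<open>k \<ge> 2\<close> whose coefficients solve the \<open>m\<close> equations given by the directions.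
  It is not affine-linear even as a map: an affine-linear map that agrees with it at the indicator
  vectors of sets with at most one element is zero, whereas the form takes the value of the coefficient
  of \<open>J\<close> at the indicator vector of a set \<open>J\<close> of size \<open>k\<close>.
\<close>

lemma few_directions_do_not_detect_affine_linear:
  fixes w :: "nat \<Rightarrow> 'a::comm_ring_1 vec"
  assumes k: "2 \<le> k" and m: "m < n choose k" and w: "\<And>i. i \<in> {1..m} \<Longrightarrow> w i \<in> carrier_vec n"
    and n: "1 \<le> n" and full: "vandermonde_full TYPE('a) n"
  shows "\<exists>f. multi_affine n f \<and> (\<forall>i\<in>{1..m}. affine_linear_along n f (w i)) \<and> \<not> affine_linear n f"
proof -
  define L where "L = {J. J \<subseteq> {..<n} \<and> card J = k}"
  have "finite L"
    by (rule finite_subset[of _ "Pow {..<n}"]) (auto simp: L_def)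
  moreover have "card L = n choose k"
    using n_subsets[of "{..<n}" k] by (simp add: L_def)
  ultimately obtain x where x: "\<exists>J\<in>L. x J \<noteq> 0"
      "\<And>i. i < m \<Longrightarrow> (\<Sum>J\<in>L. (\<Prod>j\<in>J. w (Suc i) $ j) * x J) = 0"
    using underdetermined_system[of L m "\<lambda>i J. \<Prod>j\<in>J. w (Suc i) $ j"] m by metis
  define a where "a J = (if J \<in> L then x J else 0)" for J
  define f where "f v = (\<Sum>J\<in>Pow {..<n}. a J * (\<Prod>j\<in>J. v $ j))" for v
  have f: "\<forall>v\<in>carrier_vec n. f v = (\<Sum>J\<in>Pow {..<n}. a J * (\<Prod>j\<in>J. v $ j))"
    by (simp add: f_def)
  have f_level: "f v = level_form n k a v" for v
    unfolding f_def level_form_def by (rule sum.mono_neutral_right) (auto simp: a_def L_def)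
  have "affine_linear_along n f (w i)" if i: "i \<in> {1..m}" for i
  proof -
    have "level_form n k' a (w i) = 0" for k'
    proof (cases "k' = k")
      case True
      have "level_form n k a (w i) = (\<Sum>J\<in>L. (\<Prod>j\<in>J. w (Suc (i - 1)) $ j) * x J)"
        unfolding level_form_def using i by (intro sum.cong) (auto simp: a_def L_def)
      then show ?thesis
        using x(2)[of "i - 1"] i True by auto
    next
      case False
      then show ?thesis
        unfolding level_form_def by (intro sum.neutral) (auto simp: a_def L_def)
    qed
    then show ?thesis
      using affine_linear_along_iff_level_forms[OF full f w[OF i] n] by blast
  qed
  moreover have "\<not> affine_linear n f"
  proof
    assume "affine_linear n f"
    then obtain b where b: "\<And>c. c \<in> carrier_vec n \<Longrightarrow> f c = f (0\<^sub>v n) + (\<Sum>i<n. b i * c $ i)"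
      unfolding affine_linear_def by blast
    have f_ind: "f (indicator_vec n S) = level_sum k a S" if "S \<subseteq> {..<n}" for S
      using that by (simp add: f_level level_form_indicator_vec)
    have "0\<^sub>v n = (indicator_vec n {} :: 'a vec)"
      by (auto simp: indicator_vec_def)
    then have "f (0\<^sub>v n) = level_sum k a {}"
      by (simp add: f_ind)
    also have "\<dots> = 0"
      using k by (intro level_sum_eq_0) auto
    finally have f0: "f (0\<^sub>v n) = 0" .
    have b_sum: "level_sum k a S = (\<Sum>i<n. if i \<in> S then b i else 0)" if "S \<subseteq> {..<n}" for S
      unfolding f_ind[OF that, symmetric] b[OF indicator_vec_carrier] f0
      by (auto simp: indicator_vec_def intro!: sum.cong)
    have b0: "b i = 0" if "i < n" for i
    proof -
      have "card K \<noteq> k" if "K \<subseteq> {i}" for K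
        using card_mono[OF _ that] k by simp
      then have "level_sum k a {i} = 0"
        by (intro level_sum_eq_0) blast
      then show ?thesis
        using b_sum[of "{i}"] that by simp
    qed
    obtain J where J: "J \<in> L" "x J \<noteq> 0" using x(1) by blast
    then have sub: "J \<subseteq> {..<n}" and fin: "finite J" and card: "card J = k"
      using finite_subset by (auto simp: L_def)
    have "{K. K \<subseteq> J \<and> card K = k} = {J}"
      using card card_subset_eq[OF fin] by auto
    then have "level_sum k a J = x J"
      using J by (simp add: level_sum_def a_def)
    moreover have "level_sum k a J = 0"
      unfolding b_sum[OF sub] by (intro sum.neutral) (simp add: b0)
    ultimately show False
      using J by simp
  qed
  ultimately show ?thesis
    using f unfolding multi_affine_def by blast
qed

theorem theorem1:
  fixes n N :: nat
  assumes "n \<ge> 3"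
    and "N = n choose (n div 2)"
    and "vandermonde_full TYPE('a::comm_ring_1) n"
  shows "(\<exists>v :: nat \<Rightarrow> 'a vec. (\<forall>i\<in>{1..N}. v i \<in> carrier_vec n) \<and>
           (\<forall>f. multi_affine n f \<longrightarrow> (\<forall>i\<in>{1..N}. affine_linear_along n f (v i)) \<longrightarrow>
              affine_linear n f)) \<and>
         (\<forall>m<N. \<forall>w :: nat \<Rightarrow> 'a vec. (\<forall>i\<in>{1..m}. w i \<in> carrier_vec n) \<longrightarrow>
           (\<exists>f. multi_affine n f \<and> (\<forall>i\<in>{1..m}. affine_linear_along n f (w i)) \<and>
              \<not> affine_linear n f))"
proof (intro conjI allI impI)
  have n: "1 \<le> n"
    using assms(1) by simp
  let ?B = "ballot_sets n (n mod 2)"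
  obtain g where g: "g ` ?B \<subseteq> {1..N}" "inj_on g ?B"
  proof -
    have "even (n + n mod 2)" "(n - n mod 2) div 2 = n div 2"
      by presburger+
    then have "card ?B \<le> card {1..N}"
      using card_ballot_sets_le[of n "n mod 2"] assms(2) by simp
    then have "\<exists>g. g ` ?B \<subseteq> {1..N} \<and> inj_on g ?B"
      by (intro card_le_inj finite_ballot_sets) simp
    then show thesis
      using that by blast
  qed
  define v :: "nat \<Rightarrow> 'a vec" where "v i = indicator_vec n (inv_into ?B g i)" for i
  have "affine_linear n f"
    if f: "multi_affine n f" and along: "\<forall>i\<in>{1..N}. affine_linear_along n f (v i)" for f
  proof (rule affine_linear_if_affine_linear_along_ballot_sets[OF n assms(3) f])
    fix S assume S: "S \<in> ?B"
    then have "affine_linear_along n f (v (g S))"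
      using along g(1) by blast
    then show "affine_linear_along n f (indicator_vec n S)"
      using S g(2) by (simp add: v_def)
  qed
  then show "\<exists>v :: nat \<Rightarrow> 'a vec. (\<forall>i\<in>{1..N}. v i \<in> carrier_vec n) \<and>
      (\<forall>f. multi_affine n f \<longrightarrow> (\<forall>i\<in>{1..N}. affine_linear_along n f (v i)) \<longrightarrow> affine_linear n f)"
    by (intro exI[of _ v]) (auto simp: v_def indicator_vec_carrier)
next
  fix m and w :: "nat \<Rightarrow> 'a vec"
  assume m: "m < N" and w: "\<forall>i\<in>{1..m}. w i \<in> carrier_vec n"
  have "N = n choose (n - n div 2)"
    using binomial_symmetric[of "n div 2" n] assms(2) by simp
  then show "\<exists>f. multi_affine n f \<and> (\<forall>i\<in>{1..m}. affine_linear_along n f (w i)) \<and> \<not> affine_linear n f"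
    using m w assms(1,3)
    by (intro few_directions_do_not_detect_affine_linear[of "n - n div 2"]) auto
qed

end
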